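(* Let $A\in\mathbb{R}_+^{n\times n}$ be a definite and irreducible matrix with $N_c(A)=\{1,\dots,c\}$, let $\gamma$ be the cyclicity of $\mathcal{C}(A)$, and let $i,j\in\{1,\dots,c\}$ be such that $[i]\to_l[j]$ for some $0\le l<\gamma$. (1) For any $r\ge T_c(A)$, there exists $t_1\ge 0$ such that $$a^{(t_1\gamma+l)}_{ij}A^r_{\cdot i}=A^{r+l}_{\cdot j},\qquad a^{(t_1\gamma+l)}_{ij}A^r_{j\cdot}=A^{r+l}_{i\cdot}.$$ (2) If $A$ is visualized, then for all $r\ge T_c(A)$ $$A^r_{\cdot i}=A^{r+l}_{\cdot j},\qquad A^r_{j\cdot}=A^{r+l}_{i\cdot}.$$
   Context: Max algebra: on $\mathbb{R}_+=[0,\infty)$ put $a\oplus b=\max(a,b)$, $a\otimes b=ab$, extended to matrices by $(A\otimes B)_{ij}=\max_k a_{ik}b_{kj}$; $A^k$ is the $k$-th max-algebraic power ($A^0=I$), with entries $a^{(k)}_{ij}$, rows $A^k_{i\cdot}$ and columns $A^k_{\cdot i}$. The digraph $\mathcal{D}(A)$ has nodes $1,\dots,n$ and an edge $(i,j)$ of weight $a_{ij}$ iff $a_{ij}\neq 0$; the weight of a path is the product of its edge weights, and the geometric mean of a cycle with $k$ edges is its weight to the power $1/k$. $\lambda(A)$ is the maximum cycle geometric mean. $A$ is definite if $\lambda(A)=1$, and irreducible if for all nodes $i,j$ there is a path in $\mathcal{D}(A)$ from $i$ to $j$. A cycle is critical if its geometric mean equals $\lambda(A)$; the critical graph $\mathcal{C}(A)=(N_c(A),E_c(A))$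 consists of all nodes and edges belonging to critical cycles. It is assumed throughout that $N_c(A)=\{1,\dots,c\}$. A definite $A$ is visualized if $a_{ij}\le 1$ for all $i,j$ and $a_{ij}=1$ for all $(i,j)\in E_c(A)$. $\mathcal{C}(A)$ has pairwise disjoint strongly connected components $\mathcal{C}_\mu$ with cyclicities $\gamma_\mu$ (gcd of cycle lengths); the cyclicity of $\mathcal{C}(A)$ is $\gamma=\operatorname{lcm}_\mu\gamma_\mu$. For critical nodes in the same component $\mathcal{C}_\mu$, write $i\sim j$ if there is a path in $\mathcal{C}_\mu$ from $i$ to $j$ of length $\equiv 0\pmod{\gamma_\mu}$; this is an equivalence relation, whose classes $[i]$ are called cyclic classes. For classes in the same component, $[i]\to_t[j]$ means that there is a path in $\mathcal{C}_\mu$ from a node of $[i]$ to a node of $[j]$ of length $\equiv t\pmod{\gamma_\mu}$. $T_c(A)$ denotes the number after which the critical rows and columns of the powers of $A$ become periodic: $A^{r+\gamma}_{i\cdot}=A^r_{i\cdot}$ and $A^{r+\gamma}_{\cdot i}=A^r_{\cdot i}$ for all $i\in N_c(A)$ and all $r\ge T_c(A)$. *)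

theory Defs
  imports Complex_Main "HOL-Number_Theory.Cong"
    "Jordan_Normal_Form.Matrix" "Graph_Theory.Digraph_Component"
begin

text \<open>
  An \<open>n \<times> n\<close> matrix is an element of \<open>carrier_mat n n\<close>; rows, columns and graph nodes are numbered
  from 0, so the node set is \<open>{0..<n}\<close> instead of \<open>{1, ..., n}\<close>.
\<close>

definition nonneg_entries :: "real mat \<Rightarrow> bool" where
  "nonneg_entries A \<longleftrightarrow> (\<forall>i<dim_row A. \<forall>j<dim_col A. A $$ (i,j) \<ge> 0)"

text \<open>Only meaningful for \<open>dim_col A > 0\<close>, since otherwise \<open>Max\<close> is applied to the empty set.\<close>

definition max_times :: "real mat \<Rightarrow> real mat \<Rightarrow> real mat" where
  "max_times A B =
     mat (dim_row A) (dim_col B) (\<lambda>(i,j). Max ((\<lambda>k. A $$ (i,k) * B $$ (k,j)) ` {0..<dim_col A}))"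

primrec max_pow :: "real mat \<Rightarrow> nat \<Rightarrow> real mat" where
  "max_pow A 0 = 1\<^sub>m (dim_row A)"
| "max_pow A (Suc k) = max_times (max_pow A k) A"

definition mat_digraph :: "real mat \<Rightarrow> (nat, nat \<times> nat) pre_digraph" where
  "mat_digraph A =
     \<lparr> verts = {0..<dim_row A},
       arcs = {(i,j). i < dim_row A \<and> j < dim_row A \<and> A $$ (i,j) \<noteq> 0},
       tail = fst, head = snd \<rparr>"

text \<open>
  Paths may repeat nodes and are rendered by \<open>pre_digraph.awalk\<close>, which represents a path by the
  list of its arcs, so that \<open>length\<close> is its number of edges. Cycles are rendered by
  \<open>pre_digraph.cycle\<close>: nonempty closed walks, loops included, that repeat no node. There are
  finitely many of these, so the maximum cycle geometric mean is a maximum of a finite set.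
\<close>

definition path_weight :: "real mat \<Rightarrow> (nat \<times> nat) list \<Rightarrow> real" where
  "path_weight A p = prod_list (map (\<lambda>e. A $$ e) p)"

definition geometric_mean :: "real mat \<Rightarrow> (nat \<times> nat) list \<Rightarrow> real" where
  "geometric_mean A p = path_weight A p powr (1 / real (length p))"

text \<open>
  Cycles have positive weight when \<open>A\<close> is nonnegative, so inserting 0 only fixes the usual
  convention that the maximum cycle geometric mean is 0 if there are no cycles.
\<close>

definition max_cycle_mean :: "real mat \<Rightarrow> real" where
  "max_cycle_mean A = Max (insert 0 (geometric_mean A ` {p. pre_digraph.cycle (mat_digraph A) p}))"

definition definite :: "real mat \<Rightarrow> bool" where
  "definite A \<longleftrightarrow> max_cycle_mean A = 1"

definition max_irreducible :: "real mat \<Rightarrow> bool" where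
  "max_irreducible A \<longleftrightarrow> strongly_connected (mat_digraph A)"

definition critical_cycle :: "real mat \<Rightarrow> (nat \<times> nat) list \<Rightarrow> bool" where
  "critical_cycle A p \<longleftrightarrow>
     pre_digraph.cycle (mat_digraph A) p \<and> geometric_mean A p = max_cycle_mean A"

definition critical_nodes :: "real mat \<Rightarrow> nat set" where
  "critical_nodes A = (\<Union>p\<in>{p. critical_cycle A p}. fst ` set p)"

definition critical_edges :: "real mat \<Rightarrow> (nat \<times> nat) set" where
  "critical_edges A = (\<Union>p\<in>{p. critical_cycle A p}. set p)"

definition critical_graph :: "real mat \<Rightarrow> (nat, nat \<times> nat) pre_digraph" where
  "critical_graph A =
     \<lparr> verts = critical_nodes A, arcs = critical_edges A, tail = fst, head = snd \<rparr>"

definition visualized :: "real mat \<Rightarrow> bool" where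
  "visualized A \<longleftrightarrow> definite A \<and>
     (\<forall>i<dim_row A. \<forall>j<dim_col A. A $$ (i,j) \<le> 1) \<and>
     (\<forall>e\<in>critical_edges A. A $$ e = 1)"

abbreviation critical_components :: "real mat \<Rightarrow> (nat, nat \<times> nat) pre_digraph set" where
  "critical_components A \<equiv> pre_digraph.sccs (critical_graph A)"

definition component_cyclicity :: "(nat, nat \<times> nat) pre_digraph \<Rightarrow> nat" where
  "component_cyclicity H = Gcd (length ` {p. pre_digraph.cycle H p})"

definition critical_cyclicity :: "real mat \<Rightarrow> nat" where
  "critical_cyclicity A = Lcm (component_cyclicity ` critical_components A)"

definition cyclic_equiv :: "real mat \<Rightarrow> nat \<Rightarrow> nat \<Rightarrow> bool" where
  "cyclic_equiv A i j \<longleftrightarrow>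
     (\<exists>H\<in>critical_components A. \<exists>p. pre_digraph.awalk H i p j \<and>
        [length p = 0] (mod component_cyclicity H))"

definition cyclic_class :: "real mat \<Rightarrow> nat \<Rightarrow> nat set" where
  "cyclic_class A i = {j. cyclic_equiv A i j}"

definition class_arrow :: "real mat \<Rightarrow> nat \<Rightarrow> nat set \<Rightarrow> nat set \<Rightarrow> bool" where
  "class_arrow A t I J \<longleftrightarrow>
     (\<exists>H\<in>critical_components A. \<exists>u\<in>I. \<exists>v\<in>J. \<exists>p. pre_digraph.awalk H u p v \<and>
        [length p = t] (mod component_cyclicity H))"

text \<open>
  For definite irreducible matrices the critical rows and columns of the powers are ultimately
  periodic, so the least such \<open>T\<close> exists.
\<close>

definition critical_transient :: "real mat \<Rightarrow> nat" where
  "critical_transient A = (LEAST T. \<forall>r\<ge>T. \<forall>i\<in>critical_nodes A.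
     row (max_pow A (r + critical_cyclicity A)) i = row (max_pow A r) i \<and>
     col (max_pow A (r + critical_cyclicity A)) i = col (max_pow A r) i)"

end

theory Submission
  imports Defs
begin

text \<open>
  Since \<open>A\<close> is definite, closed walks have weight at most 1, and closed walks in the critical graph
  have weight exactly 1, because each critical edge can be undone by the rest of its cycle. Let \<open>\<gamma>\<close>
  be the cyclicity of the critical graph.
  Deleting from a walk a closed subwalk of length divisible by \<open>\<gamma>\<close> shows that the entries of the
  powers with exponents in one residue class mod \<open>\<gamma>\<close> attain their maximum at a small exponent. At a
  critical node there are closed walks of weight 1 of every large length divisible by \<open>\<gamma>\<close>, so in
  critical rows and columns this maximum persists for all large exponents: they are ultimately
  periodic.
  If \<open>[i]\<close> leads to \<open>[j]\<close> in \<open>l\<close> steps, there are critical walks from \<open>i\<close> to \<open>j\<close> and back of mutually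
  inverse weights \<open>\<alpha>\<close> and \<open>\<beta>\<close>, and these are the entries of suitable powers with exponents congruent
  to \<open>l\<close> and \<open>-l\<close>. By periodicity \<open>\<alpha>\<close> times column \<open>i\<close> of \<open>A\<^sup>r\<close> is at most column \<open>j\<close> of \<open>A\<^sup>r\<^sup>+\<^sup>l\<close>, and
  \<open>\<beta>\<close> gives the converse inequality; rows are similar. In the visualized case \<open>\<alpha> = 1\<close>.
\<close>

section \<open>Additive semigroups of natural numbers\<close>

text \<open>The least positive difference \<open>d = a - b\<close> of two elements of
  \<open>S\<close> turns out to be the gcd, and the large multiples of \<open>d\<close> are
  nonnegative combinations of \<open>a\<close> and \<open>b\<close>.\<close>

lemma nat_semigroup_contains_multiples_of_Gcd:
  fixes S :: "nat set"
  assumes zero: "0 \<in> S" and add: "\<And>a b. a \<in> S \<Longrightarrow> b \<in> S \<Longrightarrow> a + b \<in> S"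
  shows "\<exists>t0. \<forall>t\<ge>t0. t * Gcd S \<in> S"
proof (cases "S \<subseteq> {0}")
  case True
  then have "Gcd S = 0" by (simp add: Gcd_0_iff)
  with zero show ?thesis by (metis mult_0_right)
next
  case False
  then obtain s0 where s0: "s0 \<in> S" "s0 > 0" by auto
  have mult: "k * a \<in> S" if "a \<in> S" for k a
    by (induction k) (auto simp: zero add that)
  define D where "D = {d. d > 0 \<and> (\<exists>a\<in>S. \<exists>b\<in>S. a = b + d)}"
  define d where "d = (LEAST d. d \<in> D)"
  have "s0 \<in> D" using s0 zero by (auto simp: D_def)
  then have "d \<in> D" unfolding d_def by (rule LeastI)
  then obtain a b where ab: "a \<in> S" "b \<in> S" "a = b + d" and "d > 0"
    by (auto simp: D_def)
  have "d dvd s" if "s \<in> S" for s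
  proof (rule ccontr)
    assume "\<not> d dvd s"
    then have "s mod d > 0" by (simp add: dvd_eq_mod_eq_0)
    \<comment> \<open>Both sides are built from elements of \<open>S\<close>, so
      \<open>s mod d\<close> would be a positive difference smaller than \<open>d\<close>.\<close>
    moreover have "s + (s div d) * b = (s div d) * a + s mod d"
      by (simp add: ab(3) algebra_simps)
    moreover have "s + (s div d) * b \<in> S" "(s div d) * a \<in> S"
      using that ab mult add by auto
    ultimately have "s mod d \<in> D" unfolding D_def by blast
    then have "d \<le> s mod d" unfolding d_def by (rule Least_le)
    with mod_less_divisor[OF \<open>d > 0\<close>, of s] show False by linarith
  qed
  then have "d dvd Gcd S" by (simp add: Gcd_greatest)
  moreover have "Gcd S dvd d"
    using ab by (metis Gcd_dvd dvd_add_right_iff)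
  ultimately have d: "Gcd S = d" by (simp add: dvd_antisym)
  have "d dvd b" using ab(2) d Gcd_dvd by blast
  then obtain q where b: "b = q * d" by (metis dvd_div_mult_self)
  show ?thesis
  proof (intro exI allI impI)
    \<comment> \<open>With \<open>b = q * d\<close>, the number \<open>t * d\<close> is
      \<open>t div q\<close> copies of \<open>b\<close> plus \<open>t mod q\<close> copies of
      \<open>d\<close>. The bound \<open>q * q\<close> ensures \<open>t mod q <= t div q\<close>, so
      each of these \<open>d\<close> can be absorbed into a copy of \<open>b\<close>, turning it
      into \<open>a\<close>.\<close>
    fix t assume t: "t \<ge> q * q"
    show "t * Gcd S \<in> S"
    proof (cases "q = 0")
      case True
      then show ?thesis using ab b d mult by simp
    next
      case False
      have "t mod q \<le> t div q"
      proof -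
        have "t mod q < q" using False by simp
        moreover have "q \<le> t div q"
          using div_le_mono[OF t, of q] False by simp
        ultimately show ?thesis by linarith
      qed
      then obtain e where e: "t div q = t mod q + e" using le_Suc_ex by blast
      have "t = t div q * q + t mod q" by simp
      then have "t * d = (t div q * q + t mod q) * d" by simp
      also have "\<dots> = e * b + (t mod q) * a"
        unfolding e by (simp add: ab(3) b algebra_simps)
      finally show ?thesis using d ab mult add by simp
    qed
  qed
qed

section \<open>Closed walks, cycles and the gcd of their lengths\<close>

context wf_digraph
begin

text \<open>A closed walk that is not a cycle revisits a node, and the stretch between two visits
  splits off. The first arc is set aside before looking for the repetition, so neither piece is
  empty and both are shorter than \<open>p\<close>.\<close>

lemma closed_awalk_cases:
  assumes "awalk u p u" "p \<noteq> []"
  obtains "cycle p"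
  | q r s v where "p = q @ r @ s" "awalk u (q @ s) u" "awalk v r v" "r \<noteq> []" "q @ s \<noteq> []"
proof (cases "distinct (tl (awalk_verts u p))")
  case True
  with assms that(1) show ?thesis by (auto simp: cycle_def)
next
  case False
  from assms obtain e es where p: "p = e # es" by (cases p) auto
  with assms have e: "e \<in> arcs G" "tail G e = u" "awalk (head G e) es u"
    by (auto simp: awalk_Cons_iff)
  from False p have "\<not> distinct (awalk_verts (head G e) es)" by simp
  from awalk_not_distinct_decomp[OF e(3) this] obtain q r s w where
    *: "es = q @ r @ s" "0 < length r" "awalk (head G e) q w" "awalk w r w" "awalk w s u"
    by blast
  have "awalk (head G e) (q @ s) u" using *(3,5) by (rule awalk_appendI)
  then have "awalk u ((e # q) @ s) u" using e by (simp add: awalk_Cons_iff)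
  then show ?thesis using * p by (intro that(2)[of "e # q" r s w]) auto
qed

text \<open>Carries properties of cycles over to closed walks; used both for divisibility of lengths
  and for the weight bound.\<close>

lemma closed_awalk_induct [consumes 1, case_names Nil cycle insert]:
  assumes "awalk u p u"
    and "P []"
    and cycle: "\<And>p. cycle p \<Longrightarrow> P p"
    and insert: "\<And>q r s. P (q @ s) \<Longrightarrow> P r \<Longrightarrow> P (q @ r @ s)"
  shows "P p"
  using assms(1)
proof (induction "length p" arbitrary: u p rule: less_induct)
  case less
  show ?case
  proof (cases "p = []")
    case False
    from less.prems this show ?thesis
    proof (cases rule: closed_awalk_cases)
      case 1
      then show ?thesis by (rule cycle)
    next
      case (2 q r s v)
      then show ?thesis using less.hyps by (auto intro!: insert)
    qed
  qed (simp add: assms(2))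
qed

lemma Gcd_cycle_lengths_dvd_closed_awalk:
  assumes "awalk u p u"
  shows "Gcd (length ` {p. cycle p}) dvd length p"
  using assms
proof (induction rule: closed_awalk_induct)
  case (insert q r s)
  then have "Gcd (length ` {p. cycle p}) dvd length (q @ s) + length r" by (rule dvd_add)
  then show ?case by (simp add: add.commute add.left_commute)
qed (auto intro: Gcd_dvd)

text \<open>A detour from \<open>u\<close> through a given cycle can be walked with or without the
  cycle, and the two lengths differ by the length of the cycle. Thus the cyclicity is visible at any
  single node, where the lengths of closed walks form a semigroup.\<close>

lemma strongly_connected_Gcd_closed_awalks:
  assumes "strongly_connected G" "u \<in> verts G"
  shows "Gcd (length ` {p. awalk u p u}) = Gcd (length ` {p. cycle p})"
proof (rule dvd_antisym)
  show "Gcd (length ` {p. cycle p}) dvd Gcd (length ` {p. awalk u p u})"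
    by (auto intro!: Gcd_greatest Gcd_cycle_lengths_dvd_closed_awalk)
  show "Gcd (length ` {p. awalk u p u}) dvd Gcd (length ` {p. cycle p})"
  proof (rule Gcd_greatest, clarify)
    fix c assume "cycle c"
    then obtain v where c: "awalk v c v" by (auto simp: cycle_def)
    then have "v \<in> verts G" by auto
    with assms obtain p q where pq: "awalk u p v" "awalk v q u"
      by (meson reachable_awalk strongly_connectedE)
    have "awalk u (p @ q) u" "awalk u (p @ c @ q) u"
      using pq c by (auto intro: awalk_appendI)
    then have "Gcd (length ` {p. awalk u p u}) dvd length (p @ q)"
      and "Gcd (length ` {p. awalk u p u}) dvd length (p @ c @ q)"
      by (blast intro: Gcd_dvd)+
    moreover have "length (p @ c @ q) = length (p @ q) + length c" by simp
    ultimately show "Gcd (length ` {p. awalk u p u}) dvd length c"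
      by (metis dvd_add_right_iff)
  qed
qed

lemma strongly_connected_closed_awalk_lengths:
  assumes "strongly_connected G" "u \<in> verts G"
  shows "\<exists>t0. \<forall>t\<ge>t0. \<exists>p. awalk u p u \<and> length p = t * Gcd (length ` {p. cycle p})"
proof -
  let ?S = "length ` {p. awalk u p u}"
  have "0 \<in> ?S" using assms(2) by (auto simp: awalk_Nil_iff image_iff intro!: exI[of _ "[]"])
  moreover have "a + b \<in> ?S" if "a \<in> ?S" "b \<in> ?S" for a b
    using that by (force intro: awalk_appendI simp flip: length_append)
  ultimately have "\<exists>t0. \<forall>t\<ge>t0. t * Gcd ?S \<in> ?S"
    by (rule nat_semigroup_contains_multiples_of_Gcd)
  then show ?thesis unfolding strongly_connected_Gcd_closed_awalks[OF assms]
    by (fastforce simp: image_iff)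
qed

end

section \<open>Long walks in finite digraphs\<close>

context fin_digraph
begin

lemma finite_cycles: "finite {p. cycle p}"
proof (rule finite_subset)
  show "{p. cycle p} \<subseteq> {p. set p \<subseteq> arcs G \<and> distinct p}"
    by (auto simp: cycle_conv)
  show "finite {p. set p \<subseteq> arcs G \<and> distinct p}"
    by (rule finite_subset_distinct) simp
qed

text \<open>Pigeonhole on the pairs (node reached after \<open>t\<close> steps, \<open>t mod g\<close>).\<close>

lemma long_awalk_closed_subwalk:
  assumes "awalk u p v" "g > 0" "card (verts G) * g \<le> length p"
  obtains q r s w where "p = q @ r @ s" "awalk u q w" "awalk w r w" "awalk w s v"
    "r \<noteq> []" "g dvd length r"
proof -
  let ?f = "\<lambda>t. (awlast u (take t p), t mod g)"
  have walk: "awalk u (take t p) (awlast u (take t p))" for t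
    using assms(1) awalk_append_iff[of u "take t p" "drop t p" v] by simp
  have "?f ` {..length p} \<subseteq> verts G \<times> {..<g}"
    using walk \<open>g > 0\<close> by (auto elim!: awalkE')
  then have "card (?f ` {..length p}) \<le> card (verts G) * g"
    by (metis card_cartesian_product card_lessThan card_mono finite_SigmaI finite_lessThan finite_verts)
  \<comment> \<open>There are \<open>length p + 1\<close> prefixes, hence the strict
    inequality.\<close>
  then have "card (?f ` {..length p}) < card {..length p}" using assms(3) by simp
  then have "\<not> inj_on ?f {..length p}" by (rule pigeonhole)
  then obtain a b where ab: "a < b" "b \<le> length p" "?f a = ?f b"
    unfolding inj_on_def by (metis atMost_iff linorder_neqE_nat)
  define q r s where "q = take a p" and "r = take (b - a) (drop a p)" and "s = drop b p"
  have qr: "q @ r = take b p"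
    using ab by (simp add: q_def r_def flip: take_add)
  have p: "p = q @ r @ s" using qr by (simp add: s_def flip: append_assoc)
  let ?w = "awlast u q"
  have 1: "awalk u q ?w" using walk q_def by simp
  have w: "awlast u (q @ r) = ?w" using ab(3) by (simp only: qr) (simp add: q_def)
  have "awalk u (q @ r) ?w" using walk[of b] by (simp only: qr[symmetric] w)
  then have 2: "awalk ?w r ?w" by (simp only: awalk_append_iff)
  have "awalk u ((q @ r) @ s) v" using assms(1) p by simp
  then have 3: "awalk ?w s v" by (simp only: awalk_append_iff w)
  have len: "length r = b - a" using ab by (simp add: r_def)
  then have "r \<noteq> []" using ab(1) by auto
  moreover have "g dvd length r" using ab(3) len ab(1)
    by (metis Pair_inject less_imp_le_nat mod_eq_dvd_iff_nat)
  ultimately show ?thesis using that p 1 2 3 by blast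
qed

end

section \<open>Weights of walks of a definite matrix\<close>

lemma path_weight_Nil [simp]: "path_weight A [] = 1"
  and path_weight_Cons [simp]: "path_weight A (e # p) = A $$ e * path_weight A p"
  and path_weight_append [simp]: "path_weight A (p @ q) = path_weight A p * path_weight A q"
  by (simp_all add: path_weight_def)

locale definite_mat =
  fixes A :: "real mat" and n :: nat
  assumes carrier: "A \<in> carrier_mat n n"
    and nonneg: "nonneg_entries A"
    and definite: "definite A"
begin

abbreviation G where "G \<equiv> mat_digraph A"

lemma G_simps [simp]:
  "verts G = {0..<n}" "tail G = fst" "head G = snd"
  "arcs G = {(i,j). i < n \<and> j < n \<and> A $$ (i,j) \<noteq> 0}"
  using carrier by (auto simp: mat_digraph_def)

sublocale G: fin_digraph G
proof
  show "finite (arcs G)" by (rule finite_subset[of _ "{..<n} \<times> {..<n}"]) auto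
qed auto

lemma arc_weight_pos: "e \<in> arcs G \<Longrightarrow> A $$ e > 0"
  using nonneg carrier by (force simp: nonneg_entries_def less_eq_real_def)

lemma awalk_weight_pos:
  assumes "G.awalk u p v"
  shows "path_weight A p > 0"
  using assms
proof (induction p arbitrary: u)
  case (Cons e p)
  then have "e \<in> arcs G" by (simp only: G.awalk_Cons_iff)
  from arc_weight_pos[OF this] Cons show ?case by (auto simp: G.awalk_Cons_iff intro: mult_pos_pos)
qed simp

lemma cycle_weight_le_1:
  assumes "G.cycle p"
  shows "path_weight A p \<le> 1"
proof -
  have "geometric_mean A p \<le> max_cycle_mean A"
    unfolding max_cycle_mean_def using assms G.finite_cycles by (intro Max_ge) auto
  then have "geometric_mean A p \<le> 1" using definite by (simp add: definite_def)
  moreover have "path_weight A p > 0" "length p > 0"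
    using assms awalk_weight_pos by (auto simp: G.cycle_def)
  ultimately show ?thesis
    by (metis geometric_mean_def gr_one_powr linorder_not_le of_nat_0_less_iff zero_less_divide_1_iff)
qed

lemma critical_cycle_weight:
  assumes "critical_cycle A p"
  shows "path_weight A p = 1"
proof -
  have "G.cycle p" and g: "path_weight A p powr (1 / length p) = 1"
    using assms definite by (simp_all add: critical_cycle_def definite_def geometric_mean_def)
  then have "path_weight A p > 0" "length p > 0"
    using awalk_weight_pos by (auto simp: G.cycle_def)
  then have "path_weight A p = (path_weight A p powr (1 / length p)) powr length p"
    by (simp add: powr_powr)
  then show ?thesis unfolding g by simp
qed

lemma closed_awalk_weight_le_1:
  assumes "G.awalk u p u"
  shows "path_weight A p \<le> 1"
proof -
  \<comment> \<open>Nonnegativity is carried along so that the bounds of the two pieces can be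
    multiplied.\<close>
  have "0 \<le> path_weight A p \<and> path_weight A p \<le> 1"
    using assms
  proof (induction rule: G.closed_awalk_induct)
    case (cycle p)
    then obtain u where "G.awalk u p u" by (auto simp: G.cycle_def)
    then show ?case using cycle cycle_weight_le_1 awalk_weight_pos less_imp_le by blast
  next
    case (insert q r s)
    then have "0 \<le> path_weight A (q @ s) * path_weight A r"
      "path_weight A (q @ s) * path_weight A r \<le> 1"
      by (auto intro: mult_le_one mult_nonneg_nonneg simp del: path_weight_append)
    then show ?case by (simp add: mult_ac)
  qed simp
  then show ?thesis by simp
qed

text \<open>Cutting out a closed subwalk of length divisible by \<open>g\<close> keeps the residue
  of the length, and does not lower the weight because the removed factor is at most 1. The bound
  \<open>n * g\<close> is that of the pigeonhole argument.\<close>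

lemma shorten_awalk:
  assumes "G.awalk u p v" "g > 0"
  shows "\<exists>q. G.awalk u q v \<and> length q < n * g \<and> length q mod g = length p mod g
    \<and> path_weight A p \<le> path_weight A q"
  using assms(1)
proof (induction "length p" arbitrary: p rule: less_induct)
  case less
  show ?case
  proof (cases "length p < n * g")
    case False
    then have "card (verts G) * g \<le> length p" by simp
    from G.long_awalk_closed_subwalk[OF less.prems \<open>g > 0\<close> this] obtain q r s w
      where p: "p = q @ r @ s" and walks: "G.awalk u q w" "G.awalk w r w" "G.awalk w s v"
        and r: "r \<noteq> []" "g dvd length r" by blast
    have qs: "G.awalk u (q @ s) v" using walks(1,3) by (rule G.awalk_appendI)
    have "path_weight A r \<le> 1" using walks by (blast intro: closed_awalk_weight_le_1)
    then have "path_weight A (q @ s) * path_weight A r \<le> path_weight A (q @ s)"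
      using awalk_weight_pos[OF qs] by (intro mult_left_le) auto
    then have "path_weight A p \<le> path_weight A (q @ s)" by (simp add: p mult_ac)
    moreover have "length (q @ s) < length p" using p r by simp
    moreover have "length p = length (q @ s) + length r" by (simp add: p)
    then have "length (q @ s) mod g = length p mod g"
      using r(2) by (metis add_0_right dvd_imp_mod_0 mod_add_right_eq)
    ultimately show ?thesis using less.hyps qs by (metis order_trans)
  qed (use less.prems in auto)
qed

section \<open>Entries of max-algebraic powers as weights of walks\<close>

abbreviation entry :: "nat \<Rightarrow> nat \<Rightarrow> nat \<Rightarrow> real" where
  "entry k i j \<equiv> max_pow A k $$ (i, j)"

lemma max_pow_carrier: "max_pow A k \<in> carrier_mat n n"
  using carrier by (induction k) (auto simp: max_times_def)

lemma max_pow_dims [simp]: "dim_row (max_pow A k) = n" "dim_col (max_pow A k) = n"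
  using max_pow_carrier[of k] by auto

lemma entry_0: "i < n \<Longrightarrow> j < n \<Longrightarrow> entry 0 i j = (if i = j then 1 else 0)"
  using carrier by auto

lemma entry_Suc:
  assumes "i < n" "j < n"
  shows "entry (Suc k) i j = Max ((\<lambda>x. entry k i x * A $$ (x, j)) ` {0..<n})"
  using max_pow_carrier[of k] carrier assms by (auto simp: max_times_def)

lemma awalk_weight_le_entry:
  assumes "G.awalk i p j"
  shows "path_weight A p \<le> entry (length p) i j"
  using assms
proof (induction p arbitrary: j rule: rev_induct)
  case Nil
  then show ?case by (simp add: G.awalk_Nil_iff entry_0 del: max_pow.simps)
next
  case (snoc e p)
  then have p: "G.awalk i p (fst e)" and e: "e \<in> arcs G" "snd e = j"
    by (auto simp: G.awalk_Cons_iff G.awalk_Nil_iff)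
  have ij: "i < n" "j < n" "fst e < n"
    using G.awalk_hd_in_verts[OF snoc.prems] G.awalk_last_in_verts[OF snoc.prems] e by auto
  have "path_weight A (p @ [e]) = path_weight A p * A $$ e" by simp
  also have "\<dots> \<le> entry (length p) i (fst e) * A $$ e"
    using snoc.IH[OF p] arc_weight_pos[OF e(1)] by (intro mult_right_mono) auto
  also have "\<dots> = entry (length p) i (fst e) * A $$ (fst e, j)" using e(2) by auto
  also have "\<dots> \<le> entry (Suc (length p)) i j"
    unfolding entry_Suc[OF ij(1,2)] using ij by (intro Max_ge) auto
  finally show ?case by simp
qed

text \<open>Together with \<open>awalk_weight_le_entry\<close>, this identifies the entry as the
  largest weight of a walk of length \<open>k\<close>, or 0 if there is none.\<close>

lemma entry_cases:
  assumes "i < n" "j < n"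
  obtains "entry k i j = 0"
  | p where "G.awalk i p j" "length p = k" "entry k i j = path_weight A p"
proof -
  have "entry k i j = 0 \<or> (\<exists>p. G.awalk i p j \<and> length p = k \<and> entry k i j = path_weight A p)"
    using assms(2)
  proof (induction k arbitrary: j)
    case 0
    then show ?case using assms(1)
      by (auto simp: entry_0 G.awalk_Nil_iff simp del: max_pow.simps)
  next
    case (Suc k)
    have "entry (Suc k) i j \<in> (\<lambda>x. entry k i x * A $$ (x, j)) ` {0..<n}"
      unfolding entry_Suc[OF assms(1) Suc.prems] using assms(1) by (intro Max_in) auto
    then obtain x where x: "x < n" "entry (Suc k) i j = entry k i x * A $$ (x, j)" by auto
    show ?case
    proof (cases "entry k i x = 0 \<or> A $$ (x, j) = 0")
      case False
      with Suc.IH[OF x(1)] obtain p where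
        p: "G.awalk i p x" "length p = k" "entry k i x = path_weight A p" by auto
      have "G.awalk x [(x, j)] j" using False x Suc.prems by (simp add: G.awalk_simps)
      with p(1) have "G.awalk i (p @ [(x, j)]) j" by (rule G.awalk_appendI)
      then show ?thesis using p x by (intro disjI2 exI[of _ "p @ [(x, j)]"]) simp
    qed (use x in auto)
  qed
  with that show ?thesis by blast
qed

lemma entry_nonneg:
  assumes "i < n" "j < n"
  shows "entry k i j \<ge> 0"
  using assms by (rule entry_cases[of i j k]) (auto dest: awalk_weight_pos)

text \<open>Walks attaining the two factors are concatenated; a factor 0 makes the bound
  trivial.\<close>

lemma entry_mult_le:
  assumes "i < n" "x < n" "j < n"
  shows "entry k i x * entry m x j \<le> entry (k + m) i j"
proof (cases rule: entry_cases[OF assms(1,2), of k])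
  case (2 p)
  show ?thesis
  proof (cases rule: entry_cases[OF assms(2,3), of m])
    case (2 q)
    have "path_weight A (p @ q) \<le> entry (length (p @ q)) i j"
      using \<open>G.awalk i p x\<close> 2(1) by (intro awalk_weight_le_entry G.awalk_appendI)
    then show ?thesis using \<open>length p = k\<close> \<open>entry k i x = _\<close> 2 by simp
  qed (simp add: entry_nonneg assms)
qed (simp add: entry_nonneg assms)

lemma entry_self_le_1:
  assumes "i < n"
  shows "entry k i i \<le> 1"
  using assms assms by (rule entry_cases[of i i k]) (auto dest: closed_awalk_weight_le_1)

text \<open>
  Every entry of a power in a fixed residue class of exponents is bounded by one with
  exponent below \<open>n * g\<close>, and the hypothesis propagates that one to all large exponents.
\<close>

lemma entry_eventually_periodic:
  assumes "i < n" "j < n" "g > 0"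
    and grow: "\<And>m t. t \<ge> t0 \<Longrightarrow> entry m i j \<le> entry (m + t * g) i j"
    and r: "r \<ge> (n + t0) * g"
  shows "entry (r + g) i j = entry r i j"
proof -
  have le: "entry r' i j \<le> entry r i j" if large: "r \<ge> (n + t0) * g" and cong: "r' mod g = r mod g" for r r'
  proof (cases rule: entry_cases[OF assms(1,2), of r'])
    case 1
    then show ?thesis using entry_nonneg assms by simp
  next
    case (2 p)
    from shorten_awalk[OF 2(1) \<open>g > 0\<close>] obtain q where
      q: "G.awalk i q j" "length q < n * g" "length q mod g = r mod g"
        "path_weight A p \<le> path_weight A q"
      unfolding 2(2) cong by blast
    \<comment> \<open>Of the \<open>n + t0\<close> periods, \<open>n\<close> make room for the
      shortened walk and \<open>t0\<close> for the hypothesis \<open>grow\<close>.\<close>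
    have "length q + t0 * g \<le> r" using q(2) large by (simp add: algebra_simps)
    then have "length q \<le> r" by linarith
    with q(3) obtain t where t: "r = length q + t * g"
      by (metis add.commute le_iff_add mod_eq_nat1E mult.commute)
    have "t \<ge> t0" using \<open>length q + t0 * g \<le> r\<close> \<open>g > 0\<close> t by simp
    have "entry r' i j \<le> path_weight A q" using 2 q by simp
    also have "\<dots> \<le> entry (length q) i j" using q by (intro awalk_weight_le_entry)
    also have "\<dots> \<le> entry r i j" unfolding t using \<open>t \<ge> t0\<close> by (rule grow)
    finally show ?thesis .
  qed
  show ?thesis using r by (intro antisym le) auto
qed

section \<open>The critical graph\<close>

abbreviation C where "C \<equiv> critical_graph A"

lemma C_simps [simp]:
  "verts C = critical_nodes A" "arcs C = critical_edges A" "tail C = fst" "head C = snd"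
  by (simp_all add: critical_graph_def)

text \<open>Rotated to start with \<open>e\<close>, the cycle continues with a walk back whose
  weight is inverse to that of \<open>e\<close>. The last clause makes the critical graph
  well-formed, since \<open>critical_nodes\<close> collects tails of arcs.\<close>

lemma critical_cycle_edge:
  assumes "critical_cycle A p" "e \<in> set p"
  obtains q where "G.awalk (snd e) q (fst e)" "A $$ e * path_weight A q = 1"
    "snd e \<in> fst ` set p"
proof -
  from assms(2) obtain xs ys where p: "p = xs @ e # ys" by (metis split_list)
  from assms(1) obtain u where "G.awalk u p u"
    by (auto simp: critical_cycle_def G.cycle_def)
  then have walks: "G.awalk u xs (fst e)" "G.awalk (snd e) ys u"
    unfolding p by (auto simp: G.awalk_Cons_iff)
  let ?q = "ys @ xs"
  have q: "G.awalk (snd e) ?q (fst e)" using walks(2,1) by (rule G.awalk_appendI)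
  have "A $$ e * path_weight A ?q = 1"
    using critical_cycle_weight[OF assms(1)] by (simp add: p mult_ac)
  moreover have "snd e \<in> fst ` set p"
  proof (cases ?q)
    case Nil
    with q p show ?thesis by (simp add: G.awalk_Nil_iff)
  next
    case (Cons f fs)
    with q have "snd e = fst f" by (simp add: G.awalk_Cons_iff)
    moreover have "f \<in> set ?q" unfolding Cons by simp
    ultimately show ?thesis using p by auto
  qed
  ultimately show ?thesis using that q by blast
qed

lemma critical_edges_subset: "critical_edges A \<subseteq> arcs G"
  by (auto simp: critical_edges_def critical_cycle_def G.cycle_def simp del: G_simps)

sublocale C: wf_digraph C
proof
  fix e assume "e \<in> arcs C"
  then obtain p where p: "critical_cycle A p" "e \<in> set p" by (auto simp: critical_edges_def)
  then show "tail C e \<in> verts C" by (auto simp: critical_nodes_def)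
  from p have "snd e \<in> fst ` set p" by (rule critical_cycle_edge)
  with p(1) show "head C e \<in> verts C" unfolding C_simps critical_nodes_def by blast
qed

lemma critical_nodes_subset: "critical_nodes A \<subseteq> {0..<n}"
  using critical_edges_subset by (fastforce simp: critical_nodes_def critical_edges_def)

lemma C_subgraph: "subgraph C G"
  using critical_edges_subset critical_nodes_subset C.wf_digraph G.wf_digraph
  by (intro subgraphI) (auto simp: compatible_def simp del: G_simps(4))

text \<open>The arcs are undone one by one in reverse order, each by the rest of a critical cycle
  through it.\<close>

lemma critical_awalk_return:
  assumes "C.awalk u p v"
  shows "\<exists>q. G.awalk v q u \<and> path_weight A p * path_weight A q = 1"
  using assms
proof (induction p arbitrary: u)
  case Nil
  then show ?case using critical_nodes_subset
    by (intro exI[of _ "[]"]) (auto simp: C.awalk_Nil_iff G.awalk_Nil_iff)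
next
  case (Cons e p)
  then have e: "e \<in> critical_edges A" "u = fst e" "C.awalk (snd e) p v"
    by (simp_all add: C.awalk_Cons_iff)
  from Cons.IH[OF e(3)] obtain q where
    q: "G.awalk v q (snd e)" "path_weight A p * path_weight A q = 1" by blast
  from e(1) obtain c where c: "critical_cycle A c" "e \<in> set c"
    by (auto simp: critical_edges_def)
  from c obtain q' where
    q': "G.awalk (snd e) q' (fst e)" "A $$ e * path_weight A q' = 1"
    by (rule critical_cycle_edge)
  have "G.awalk v (q @ q') u" using q(1) q'(1) e(2) by (simp add: G.awalk_appendI)
  moreover have "path_weight A (e # p) * path_weight A (q @ q') = 1"
    using q(2) q'(2) by (simp add: mult_ac) (metis mult.assoc mult.left_commute mult_1_right)
  ultimately show ?case by blast
qed

lemma critical_node_in_component: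
  assumes "i \<in> critical_nodes A"
  obtains H where "H \<in> critical_components A" "i \<in> verts H"
proof -
  have "i \<in> C.scc_of i" "C.scc_of i \<in> C.sccs_verts"
    using assms by (simp_all add: C.in_scc_of_self C.scc_of_in_sccs_verts)
  with that show ?thesis unfolding C.sccs_verts_conv by blast
qed

end

section \<open>A strongly connected component of the critical graph\<close>

locale critical_component = definite_mat +
  fixes H :: "(nat, nat \<times> nat) pre_digraph"
  assumes component: "H \<in> critical_components A"
begin

lemma H_subgraph: "subgraph H C"
  and H_strongly_connected: "strongly_connected H"
  using component by (auto simp: C.sccs_def induced_subgraph_def)

sublocale H: wf_digraph H
  using H_subgraph by auto

lemma H_awalk:
  assumes "H.awalk u p v"
  shows "C.awalk u p v" "G.awalk u p v"
  using assms H_subgraph C_subgraph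
  by (auto intro: C.subgraph_awalk_imp_awalk G.subgraph_awalk_imp_awalk subgraph_trans)

lemma H_verts: "verts H \<subseteq> critical_nodes A"
  using H_subgraph by (auto simp: subgraph_def)

text \<open>The return walk is closed too, so two weights that are at most 1 have product 1.\<close>

lemma closed_awalk_weight:
  assumes "H.awalk u p u"
  shows "path_weight A p = 1"
proof -
  from critical_awalk_return[OF H_awalk(1)[OF assms]] obtain q where
    q: "G.awalk u q u" "path_weight A p * path_weight A q = 1" by blast
  moreover have "0 < path_weight A p" "path_weight A p \<le> 1" "path_weight A q \<le> 1"
    using H_awalk(2)[OF assms] q(1) by (auto intro: closed_awalk_weight_le_1 awalk_weight_pos)
  ultimately show ?thesis using mult_left_le[of "path_weight A q" "path_weight A p"] by simp
qed

text \<open>Closed walks at \<open>i\<close> inside \<open>H\<close> have weight 1 and realize every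
  large multiple of the cyclicity of \<open>H\<close>; putting one in front of \<open>p\<close> pads
  it to length \<open>t * g + l\<close> at no cost. The period \<open>g\<close> may be a proper
  multiple of that cyclicity because \<gamma> is an lcm over all components.\<close>

lemma awalk_weight_le_entry_eventually:
  assumes p: "H.awalk i p j" "[length p = l] (mod component_cyclicity H)"
    and g: "component_cyclicity H dvd g" "g > 0"
  obtains t0 where "\<And>t. t \<ge> t0 \<Longrightarrow> path_weight A p \<le> entry (t * g + l) i j"
proof -
  let ?h = "component_cyclicity H"
  have "?h > 0" using g by (auto intro: Nat.gr0I)
  have "i \<in> verts H" using p(1) by auto
  from H.strongly_connected_closed_awalk_lengths[OF H_strongly_connected this]
  obtain s0 where s0: "\<And>s. s \<ge> s0 \<Longrightarrow> \<exists>c. H.awalk i c i \<and> length c = s * ?h"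
    unfolding component_cyclicity_def by blast
  show ?thesis
  proof (rule that)
    \<comment> \<open>This threshold leaves at least \<open>s0 * ?h\<close> steps for the
      padding.\<close>
    fix t assume t: "t \<ge> s0 * ?h + length p"
    have "t \<le> t * g" using g(2) by simp
    with t have le: "s0 * ?h + length p \<le> t * g + l" by linarith
    have "[t * g + l = 0 + length p] (mod ?h)"
      using p(2) g(1) by (intro cong_add) (auto simp: cong_0_iff intro: cong_sym)
    then have "?h dvd t * g + l - length p"
      using le by (metis add_0 add_leD2 cong_altdef_nat)
    then obtain s where s: "t * g + l - length p = s * ?h"
      by (metis dvd_div_mult_self)
    have "s0 * ?h \<le> s * ?h" unfolding s[symmetric] using le by linarith
    then have "s \<ge> s0" using \<open>?h > 0\<close> by simp
    from s0[OF this] obtain c where c: "H.awalk i c i" "length c = s * ?h" by blast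
    have "G.awalk i (c @ p) j" using H_awalk(2) c(1) p(1) by (blast intro: G.awalk_appendI)
    from awalk_weight_le_entry[OF this] have "path_weight A p \<le> entry (length (c @ p)) i j"
      using closed_awalk_weight[OF c(1)] by simp
    also have "length (c @ p) = t * g + l" using c(2) s le by simp
    finally show "path_weight A p \<le> entry (t * g + l) i j" .
  qed
qed

lemma component_cyclicity_dvd: "component_cyclicity H dvd critical_cyclicity A"
  using component by (auto simp: critical_cyclicity_def)

end

section \<open>Ultimate periodicity of critical rows and columns\<close>

context definite_mat
begin

text \<open>The empty walk at \<open>i\<close>, of weight 1, is padded by closed critical
  walks.\<close>

lemma critical_diagonal:
  assumes "i \<in> critical_nodes A" "critical_cyclicity A > 0"
  shows "\<exists>t0. \<forall>t\<ge>t0. entry (t * critical_cyclicity A) i i \<ge> 1"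
proof -
  from assms(1) obtain H where H: "H \<in> critical_components A" "i \<in> verts H"
    by (rule critical_node_in_component)
  interpret critical_component A n H by unfold_locales (rule H)
  have "H.awalk i [] i" using H by (simp add: H.awalk_Nil_iff)
  from awalk_weight_le_entry_eventually[OF this _ component_cyclicity_dvd assms(2), of 0]
  obtain t0 where "\<And>t. t \<ge> t0 \<Longrightarrow>
      path_weight A [] \<le> entry (t * critical_cyclicity A + 0) i i"
    by auto
  then show ?thesis by auto
qed

text \<open>Gives meaning to the \<open>LEAST\<close> in \<open>critical_transient\<close>.
  Multiplying by a diagonal entry that is at least 1 supplies the growth hypothesis of
  \<open>entry_eventually_periodic\<close>.\<close>

lemma critical_transient_exists:
  assumes g: "critical_cyclicity A > 0"
  shows "\<exists>T. \<forall>r\<ge>T. \<forall>i\<in>critical_nodes A.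
     row (max_pow A (r + critical_cyclicity A)) i = row (max_pow A r) i \<and>
     col (max_pow A (r + critical_cyclicity A)) i = col (max_pow A r) i"
proof -
  let ?g = "critical_cyclicity A"
  have fin: "finite (critical_nodes A)"
    using critical_nodes_subset by (rule finite_subset) simp
  \<comment> \<open>The threshold depends on the node; the maximum over the finitely many critical
    nodes makes it uniform.\<close>
  have "\<exists>f. \<forall>i\<in>critical_nodes A. \<forall>t\<ge>f i. entry (t * ?g) i i \<ge> 1"
    using critical_diagonal g by (intro bchoice) auto
  then obtain f where f: "\<And>i t. i \<in> critical_nodes A \<Longrightarrow> t \<ge> f i \<Longrightarrow> entry (t * ?g) i i \<ge> 1"
    by blast
  define t0 where "t0 = Max (f ` critical_nodes A)"
  have t0: "entry (t * ?g) i i \<ge> 1" if "i \<in> critical_nodes A" "t \<ge> t0" for i t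
  proof (rule f[OF that(1)])
    have "f i \<le> t0" unfolding t0_def using fin that(1) by (intro Max_ge) auto
    with that(2) show "f i \<le> t" by simp
  qed
  show ?thesis
  proof (intro exI allI impI ballI)
    fix r i assume r: "r \<ge> (n + t0) * ?g" and i: "i \<in> critical_nodes A"
    then have "i < n" using critical_nodes_subset by auto
    have row: "entry (r + ?g) i j = entry r i j" if "j < n" for j
    proof (rule entry_eventually_periodic[OF \<open>i < n\<close> that g _ r])
      fix m t assume "t \<ge> t0"
      then have "entry m i j \<le> entry (t * ?g) i i * entry m i j"
        using mult_right_mono[OF t0[OF i] entry_nonneg[OF \<open>i < n\<close> that]] by simp
      also have "\<dots> \<le> entry (t * ?g + m) i j"
        using \<open>i < n\<close> that by (intro entry_mult_le)
      finally show "entry m i j \<le> entry (m + t * ?g) i j" by (simp add: add.commute)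
    qed
    have col: "entry (r + ?g) j i = entry r j i" if "j < n" for j
    proof (rule entry_eventually_periodic[OF that \<open>i < n\<close> g _ r])
      fix m t assume "t \<ge> t0"
      then have "entry m j i \<le> entry m j i * entry (t * ?g) i i"
        using mult_left_mono[OF t0[OF i] entry_nonneg[OF that \<open>i < n\<close>]] by simp
      also have "\<dots> \<le> entry (m + t * ?g) j i"
        using \<open>i < n\<close> that by (intro entry_mult_le)
      finally show "entry m j i \<le> entry (m + t * ?g) j i" .
    qed
    show "row (max_pow A (r + ?g)) i = row (max_pow A r) i \<and>
          col (max_pow A (r + ?g)) i = col (max_pow A r) i"
      using \<open>i < n\<close> row col by (auto intro!: eq_vecI)
  qed
qed

lemma critical_periodic:
  assumes g: "critical_cyclicity A > 0"
    and r: "r \<ge> critical_transient A" and i: "i \<in> critical_nodes A" and x: "x < n"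
  shows "entry (r + t * critical_cyclicity A) i x = entry r i x"
    and "entry (r + t * critical_cyclicity A) x i = entry r x i"
proof -
  let ?g = "critical_cyclicity A"
  have "i < n" using i critical_nodes_subset by auto
  have "row (max_pow A (r + ?g)) i = row (max_pow A r) i \<and>
        col (max_pow A (r + ?g)) i = col (max_pow A r) i" if "r \<ge> critical_transient A" for r
    using LeastI_ex[OF critical_transient_exists[OF g]] i that
    unfolding critical_transient_def by blast
  then have vec: "row (max_pow A (r + ?g)) i $ x = row (max_pow A r) i $ x"
      "col (max_pow A (r + ?g)) i $ x = col (max_pow A r) i $ x"
    if "r \<ge> critical_transient A" for r
    using that by auto
  have step: "entry (r + ?g) i x = entry r i x" "entry (r + ?g) x i = entry r x i"
    if "r \<ge> critical_transient A" for r
    using vec[OF that] \<open>i < n\<close> x by simp_all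
  show "entry (r + t * ?g) i x = entry r i x"
  proof (induction t)
    case (Suc t)
    then show ?case using step(1)[of "r + t * ?g"] r by (simp add: algebra_simps)
  qed simp
  show "entry (r + t * ?g) x i = entry r x i"
  proof (induction t)
    case (Suc t)
    then show ?case using step(2)[of "r + t * ?g"] r by (simp add: algebra_simps)
  qed simp
qed

end

section \<open>Shifting critical rows and columns along a critical walk\<close>

context critical_component
begin

lemma visualized_awalk_weight:
  assumes "visualized A" "H.awalk u p v"
  shows "path_weight A p = 1"
proof -
  have "\<forall>e\<in>set p. A $$ e = 1"
    using assms H_awalk(1)[OF assms(2)] by (auto simp: visualized_def C.awalk_def)
  then show ?thesis by (induction p) auto
qed

text \<open>The exponent is obtained from the walk \<open>p\<close> before any \<open>r\<close> is
  considered, so one \<open>t1\<close> serves all \<open>r\<close>, and the scalar is the weight of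
  \<open>p\<close>.\<close>

lemma critical_shift:
  assumes l: "l < critical_cyclicity A"
    and p: "H.awalk i p j" "[length p = l] (mod component_cyclicity H)"
  obtains t1 where "entry (t1 * critical_cyclicity A + l) i j = path_weight A p"
    and "\<And>r x. r \<ge> critical_transient A \<Longrightarrow> x < n \<Longrightarrow>
      path_weight A p * entry r x i = entry (r + l) x j"
    and "\<And>r x. r \<ge> critical_transient A \<Longrightarrow> x < n \<Longrightarrow>
      path_weight A p * entry r j x = entry (r + l) i x"
proof -
  let ?g = "critical_cyclicity A" and ?h = "component_cyclicity H"
  have g: "?g > 0" using l by simp
  have ij: "i \<in> verts H" "j \<in> verts H" using p(1) by auto
  then have crit: "i \<in> critical_nodes A" "j \<in> critical_nodes A" using H_verts by auto
  then have n: "i < n" "j < n" using critical_nodes_subset by auto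
  from ij H_strongly_connected obtain q where q: "H.awalk j q i"
    by (meson H.reachable_awalk strongly_connectedE)
  have pq: "H.awalk i (p @ q) i" using p(1) q by (rule H.awalk_appendI)
  have w: "path_weight A p * path_weight A q = 1"
    using closed_awalk_weight[OF pq] by simp
  have "?h dvd length (p @ q)"
    using H.Gcd_cycle_lengths_dvd_closed_awalk[OF pq] by (simp add: component_cyclicity_def)
  \<comment> \<open>The sum on the right is \<gamma>, a multiple of \<open>?h\<close>; cancelling
    \<open>p\<close> shows that \<open>q\<close> has length \<open>-l\<close> modulo
    \<open>?h\<close>, written as \<open>?g - l\<close> in the naturals.\<close>
  then have "[length p + length q = l + (?g - l)] (mod ?h)"
    using l component_cyclicity_dvd by (simp add: cong_def mod_eq_0_iff_dvd)
  moreover have "[l + length q = length p + length q] (mod ?h)"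
    using p(2) by (simp add: cong_add_rcancel_nat cong_sym)
  ultimately have q_len: "[length q = ?g - l] (mod ?h)"
    by (metis cong_add_lcancel_nat cong_trans)
  obtain t1 where t1: "path_weight A p \<le> entry (t1 * ?g + l) i j"
    using awalk_weight_le_entry_eventually[OF p component_cyclicity_dvd g] by blast
  obtain t2 where t2: "path_weight A q \<le> entry (t2 * ?g + (?g - l)) j i"
    using awalk_weight_le_entry_eventually[OF q q_len component_cyclicity_dvd g] by blast
  let ?a = "entry (t1 * ?g + l) i j" and ?b = "entry (t2 * ?g + (?g - l)) j i"
  have pos: "path_weight A p > 0" "path_weight A q > 0"
    using p(1) q by (auto dest!: H_awalk(2) intro: awalk_weight_pos)
  \<comment> \<open>The product is bounded by a diagonal entry, hence by 1; as \<open>?b\<close> is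
    at least the inverse of the weight of \<open>p\<close>, the entry \<open>?a\<close> cannot
    exceed that weight.\<close>
  have "?a * ?b \<le> 1"
    using entry_mult_le[OF n(1,2,1)] entry_self_le_1[OF n(1)] by (rule order_trans)
  moreover have "?a * path_weight A q \<le> ?a * ?b"
    using t2 entry_nonneg[OF n] by (rule mult_left_mono)
  ultimately have "?a * path_weight A q \<le> path_weight A p * path_weight A q"
    using w by simp
  then have a: "?a = path_weight A p" using t1 pos by simp
  show ?thesis
  proof (rule that)
    show "?a = path_weight A p" by (rule a)
  next
    fix r x assume r: "r \<ge> critical_transient A" and x: "x < n"
    have rl: "r + l \<ge> critical_transient A" using r by simp
    \<comment> \<open>Going forth adds \<open>l\<close> and \<open>t1\<close> whole periods; coming
      back completes \<open>l\<close> to one more period, hence \<open>Suc t2\<close>. Periodicity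
      then removes the periods.\<close>
    have exps: "r + (t1 * ?g + l) = r + l + t1 * ?g"
      "r + l + (t2 * ?g + (?g - l)) = r + Suc t2 * ?g"
      using l by simp_all
    have up: "entry r x i * ?a \<le> entry (r + l) x j"
      using entry_mult_le[OF x n, of r "t1 * ?g + l"]
      unfolding exps critical_periodic(2)[OF g rl crit(2) x] .
    have "entry (r + l) x j * path_weight A q \<le> entry (r + l) x j * ?b"
      using t2 entry_nonneg[OF x n(2)] by (rule mult_left_mono)
    also have "\<dots> \<le> entry r x i"
      using entry_mult_le[OF x n(2,1), of "r + l" "t2 * ?g + (?g - l)"]
      unfolding exps critical_periodic(2)[OF g r crit(1) x] .
    finally have "path_weight A p * (entry (r + l) x j * path_weight A q)
        \<le> path_weight A p * entry r x i"
      using pos by simp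
    \<comment> \<open>The weights of \<open>p\<close> and \<open>q\<close> cancel.\<close>
    moreover have "path_weight A p * (entry (r + l) x j * path_weight A q) = entry (r + l) x j"
      using w by (metis mult.left_commute mult.right_neutral)
    ultimately have "entry (r + l) x j \<le> path_weight A p * entry r x i" by (simp only:)
    then show "path_weight A p * entry r x i = entry (r + l) x j"
      using up unfolding a mult.commute[of "entry r x i"] by (rule antisym[rotated])
  next
    fix r x assume r: "r \<ge> critical_transient A" and x: "x < n"
    have rl: "r + l \<ge> critical_transient A" using r by simp
    have exps: "t1 * ?g + l + r = r + l + t1 * ?g"
      "t2 * ?g + (?g - l) + (r + l) = r + Suc t2 * ?g"
      using l by simp_all
    have up: "?a * entry r j x \<le> entry (r + l) i x"
      using entry_mult_le[OF n x, of "t1 * ?g + l" r]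
      unfolding exps critical_periodic(1)[OF g rl crit(1) x] .
    have "path_weight A q * entry (r + l) i x \<le> ?b * entry (r + l) i x"
      using t2 entry_nonneg[OF n(1) x] by (rule mult_right_mono)
    also have "\<dots> \<le> entry r j x"
      using entry_mult_le[OF n(2,1) x, of "t2 * ?g + (?g - l)" "r + l"]
      unfolding exps critical_periodic(1)[OF g r crit(2) x] .
    finally have "path_weight A p * (path_weight A q * entry (r + l) i x)
        \<le> path_weight A p * entry r j x"
      using pos by simp
    moreover have "path_weight A p * (path_weight A q * entry (r + l) i x) = entry (r + l) i x"
      using w by (metis mult.assoc mult_1)
    ultimately have "entry (r + l) i x \<le> path_weight A p * entry r j x" by (simp only:)
    then show "path_weight A p * entry r j x = entry (r + l) i x"
      using up unfolding a by (rule antisym[rotated])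
  qed
qed

end

section \<open>From cyclic classes to nodes, and the conclusion\<close>

context definite_mat
begin

text \<open>The arrow only joins some representatives \<open>u\<close> and \<open>v\<close>. The
  walk between them is extended at both ends, inside one component, by walks of length 0 modulo its
  cyclicity.\<close>

lemma class_arrow_awalk:
  assumes "class_arrow A l (cyclic_class A i) (cyclic_class A j)"
  obtains H p where "H \<in> critical_components A" "pre_digraph.awalk H i p j"
    "[length p = l] (mod component_cyclicity H)"
proof -
  from assms obtain H u v p where H: "H \<in> critical_components A"
    and p: "pre_digraph.awalk H u p v" "[length p = l] (mod component_cyclicity H)"
    and iu: "cyclic_equiv A i u" and jv: "cyclic_equiv A j v"
    by (auto simp: class_arrow_def cyclic_class_def)
  interpret critical_component A n H by unfold_locales (rule H)
  \<comment> \<open>The definitions choose a component separately for each relation; components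
    sharing a node coincide.\<close>
  have same: "H' = H" if "H' \<in> critical_components A" "pre_digraph.awalk H' x q y" "y \<in> verts H"
    for H' x q y
  proof -
    interpret H': critical_component A n H' by unfold_locales (rule that(1))
    have "y \<in> verts H'" using that(2) by auto
    with that H show ?thesis using C.scc_disj by blast
  qed
  have uv: "u \<in> verts H" "v \<in> verts H" using p(1) by auto
  from iu uv same obtain a where
    a: "H.awalk i a u" "[length a = 0] (mod component_cyclicity H)"
    unfolding cyclic_equiv_def by metis
  from jv uv same obtain b where
    b: "H.awalk j b v" "[length b = 0] (mod component_cyclicity H)"
    unfolding cyclic_equiv_def by metis
  \<comment> \<open>The equivalence of \<open>j\<close> and \<open>v\<close> gives a walk
    \<open>b\<close> from \<open>j\<close> to \<open>v\<close>, whereas one from \<open>v\<close> to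
    \<open>j\<close> is wanted. Any walk \<open>c\<close> back closes \<open>b\<close> up, so its
    length is also 0 modulo the cyclicity.\<close>
  have "j \<in> verts H" using b(1) by auto
  with uv H_strongly_connected obtain c where c: "H.awalk v c j"
    by (meson H.reachable_awalk strongly_connectedE)
  have "H.awalk v (c @ b) v" using c b(1) by (rule H.awalk_appendI)
  from H.Gcd_cycle_lengths_dvd_closed_awalk[OF this]
  have "component_cyclicity H dvd length c + length b" by (simp add: component_cyclicity_def)
  then have "[length c = 0] (mod component_cyclicity H)"
    using b(2) by (simp add: cong_0_iff dvd_add_left_iff)
  then have "[length a + (length p + length c) = 0 + (l + 0)] (mod component_cyclicity H)"
    using a(2) p(2) by (intro cong_add)
  moreover have "H.awalk i (a @ p @ c) j" using a(1) p(1) c by (intro H.awalk_appendI)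
  ultimately show ?thesis using that[OF H, of "a @ p @ c"] by simp
qed

end

theorem proposition4p6:
  fixes A :: "real mat" and n c i j l :: nat
  assumes "A \<in> carrier_mat n n"
    and "nonneg_entries A"
    and "definite A"
    and "max_irreducible A"
    and "critical_nodes A = {0..<c}"
    and "i < c" and "j < c"
    and "l < critical_cyclicity A"
    and "class_arrow A l (cyclic_class A i) (cyclic_class A j)"
  shows "(\<forall>r\<ge>critical_transient A. \<exists>t1.
            max_pow A (t1 * critical_cyclicity A + l) $$ (i,j) \<cdot>\<^sub>v col (max_pow A r) i
              = col (max_pow A (r + l)) j \<and>
            max_pow A (t1 * critical_cyclicity A + l) $$ (i,j) \<cdot>\<^sub>v row (max_pow A r) j
              = row (max_pow A (r + l)) i) \<and>
         (visualized A \<longrightarrow>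
            (\<forall>r\<ge>critical_transient A.
               col (max_pow A r) i = col (max_pow A (r + l)) j \<and>
               row (max_pow A r) j = row (max_pow A (r + l)) i))"
proof -
  interpret definite_mat A n using assms(1-3) by unfold_locales
  from assms(9) obtain H p where H: "H \<in> critical_components A"
    and p: "pre_digraph.awalk H i p j" "[length p = l] (mod component_cyclicity H)"
    by (rule class_arrow_awalk)
  interpret critical_component A n H by unfold_locales (rule H)
  from assms(8) p obtain t1 where
    t1: "entry (t1 * critical_cyclicity A + l) i j = path_weight A p"
    and shift: "\<And>r x. r \<ge> critical_transient A \<Longrightarrow> x < n \<Longrightarrow>
      path_weight A p * entry r x i = entry (r + l) x j"
      "\<And>r x. r \<ge> critical_transient A \<Longrightarrow> x < n \<Longrightarrow>
      path_weight A p * entry r j x = entry (r + l) i x"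
    using critical_shift by metis
  have n: "i < n" "j < n" using H_awalk(2)[OF p(1)] by auto
  have eq: "path_weight A p \<cdot>\<^sub>v col (max_pow A r) i = col (max_pow A (r + l)) j \<and>
      path_weight A p \<cdot>\<^sub>v row (max_pow A r) j = row (max_pow A (r + l)) i"
    if "r \<ge> critical_transient A" for r
    using shift[OF that] n by (auto intro!: eq_vecI)
  show ?thesis
  proof (intro conjI impI allI)
    fix r assume r: "r \<ge> critical_transient A"
    show "\<exists>t1. max_pow A (t1 * critical_cyclicity A + l) $$ (i,j) \<cdot>\<^sub>v col (max_pow A r) i
          = col (max_pow A (r + l)) j \<and>
        max_pow A (t1 * critical_cyclicity A + l) $$ (i,j) \<cdot>\<^sub>v row (max_pow A r) j
          = row (max_pow A (r + l)) i"
      using eq[OF r] t1 by metis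
    assume "visualized A"
    then have "path_weight A p = 1" using p(1) by (rule visualized_awalk_weight)
    with eq[OF r] show "col (max_pow A r) i = col (max_pow A (r + l)) j"
      "row (max_pow A r) j = row (max_pow A (r + l)) i"
      by simp_all
  qed
qed

end
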